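(* Let $\mathcal A$ be a finitely generated associative algebra over $\mathbb C$, let $\{\!\!\{\_\}\!\!\}:\mathcal A\otimes\mathcal A\to\mathcal A\otimes\mathcal A$ be a modified double Poisson bracket on $\mathcal A$, and let $\{\_\}:=\mu\circ\{\!\!\{\_\}\!\!\}:\mathcal A\otimes\mathcal A\to\mathcal A$, where $\mu$ is the multiplication of $\mathcal A$; write $\{a,b\}=\{a\otimes b\}$. Then $\{\_\}$ is an $H_0$-Poisson structure, namely for all $a,b,c\in\mathcal A$: (i) $\{a,bc\}=b\{a,c\}+\{a,b\}c$; (ii) $\{ab,c\}=\{ba,c\}$; (iii) $\{a,\{b,c\}\}-\{b,\{a,c\}\}=\{\{a,b\},c\}$; (iv) $\{a,b\}+\{b,a\}\equiv 0 \bmod [\mathcal A,\mathcal A]$.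
   Context: All algebras and tensor products are over $\mathbb C$; $\mathcal A$ is unital, generated by $x^{(1)},\dots,x^{(k)}$ with a finite set of relations. $[\mathcal A,\mathcal A]$ denotes the linear span of all commutators $ab-ba$. Products in $\mathcal A\otimes\mathcal A$ are componentwise: $(a\otimes b)(c\otimes d)=ac\otimes bd$. A modified double Poisson bracket on $\mathcal A$ is a linear map $\{\!\!\{\_\}\!\!\}:\mathcal A\otimes\mathcal A\to\mathcal A\otimes\mathcal A$ such that, for all $a,b,c\in\mathcal A$ and with $\{\_\}:=\mu\circ\{\!\!\{\_\}\!\!\}$: (1) $\{\!\!\{a\otimes bc\}\!\!\}=(b\otimes 1)\{\!\!\{a\otimes c\}\!\!\}+\{\!\!\{a\otimes b\}\!\!\}(1\otimes c)$; (2) $\{\!\!\{ab\otimes c\}\!\!\}=(1\otimes a)\{\!\!\{b\otimes c\}\!\!\}+\{\!\!\{a\otimes c\}\!\!\}(b\otimes 1)$; (3) $\{a\otimes\{b\otimes c\}\}-\{b\otimes\{a\otimes c\}\}=\{\{a\otimes b\}\otimes c\}$; (4) $\{a\otimes b\}+\{b\otimes a\}\in[\mathcal A,\mathcal A]$. An $H_0$-Poisson structure on $\mathcal A$ is a linear map $\{\_\}:\mathcal A\otimes\mathcal A\to\mathcal A$ satisfying (i)–(iv). *)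

theory Defs
  imports Complex_Main "HOL-Library.Poly_Mapping"
begin

section \<open>Complex vector spaces and unital associative complex algebras\<close>

class scaleC =
  fixes scaleC :: "complex \<Rightarrow> 'a \<Rightarrow> 'a"  (infixr \<open>*\<^sub>C\<close> 75)

class complex_vector = scaleC + ab_group_add +
  assumes scaleC_add_right: "a *\<^sub>C (x + y) = a *\<^sub>C x + a *\<^sub>C y"
    and scaleC_add_left: "(a + b) *\<^sub>C x = a *\<^sub>C x + b *\<^sub>C x"
    and scaleC_scaleC: "a *\<^sub>C b *\<^sub>C x = (a * b) *\<^sub>C x"
    and scaleC_one: "1 *\<^sub>C x = x"

global_interpretation complex_vector: vector_space
  "scaleC :: complex \<Rightarrow> 'a \<Rightarrow> 'a::complex_vector"
  by standard (rule scaleC_add_right scaleC_add_left scaleC_scaleC scaleC_one)+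

abbreviation clinear :: "('a::complex_vector \<Rightarrow> 'b::complex_vector) \<Rightarrow> bool"
  where "clinear \<equiv> Vector_Spaces.linear scaleC scaleC"

text \<open>
  The sort constraint \<^class>\<open>monoid_mult\<close> is used instead of \<^class>\<open>ring_1\<close> because the latter
  includes \<open>0 \<noteq> 1\<close>; the zero algebra is admitted here.
\<close>

class unital_complex_algebra = complex_vector + ring + monoid_mult +
  assumes mult_scaleC_left: "a *\<^sub>C x * y = a *\<^sub>C (x * y)"
    and mult_scaleC_right: "x * a *\<^sub>C y = a *\<^sub>C (x * y)"

lemma clinearI:
  assumes "\<And>x y. f (x + y) = f x + f y" and "\<And>c x. f (c *\<^sub>C x) = c *\<^sub>C f x"
  shows "clinear f"
  by standard (use assms in auto)

lemma clinear_add: "clinear f \<Longrightarrow> f (x + y) = f x + f y"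
  and clinear_scaleC: "clinear f \<Longrightarrow> f (c *\<^sub>C x) = c *\<^sub>C f x"
  by (simp_all add: Vector_Spaces.linear_iff)

lemma clinear_zero: "clinear f \<Longrightarrow> f 0 = 0"
  by (metis clinear_add add_cancel_right_right)

lemma clinear_diff: "clinear f \<Longrightarrow> f (x - y) = f x - f y"
  by (metis add_diff_cancel clinear_add diff_add_cancel)

definition bilinearC :: "('a::complex_vector \<Rightarrow> 'b::complex_vector \<Rightarrow> 'c::complex_vector) \<Rightarrow> bool"
  where "bilinearC h \<longleftrightarrow> (\<forall>a. clinear (h a)) \<and> (\<forall>b. clinear (\<lambda>a. h a b))"

lemma bilinearCI:
  assumes "\<And>a b b'. h a (b + b') = h a b + h a b'"
    and "\<And>a a' b. h (a + a') b = h a b + h a' b"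
    and "\<And>a c b. h a (c *\<^sub>C b) = c *\<^sub>C h a b"
    and "\<And>a c b. h (c *\<^sub>C a) b = c *\<^sub>C h a b"
  shows "bilinearC h"
  unfolding bilinearC_def by (auto intro!: clinearI simp: assms)

lemma bilinearC_add_left: "bilinearC h \<Longrightarrow> h (a + a') b = h a b + h a' b"
  and bilinearC_add_right: "bilinearC h \<Longrightarrow> h a (b + b') = h a b + h a b'"
  and bilinearC_scaleC_left: "bilinearC h \<Longrightarrow> h (c *\<^sub>C a) b = c *\<^sub>C h a b"
  and bilinearC_scaleC_right: "bilinearC h \<Longrightarrow> h a (c *\<^sub>C b) = c *\<^sub>C h a b"
  unfolding bilinearC_def by (simp_all add: Vector_Spaces.linear_iff)


section \<open>The tensor product of complex vector spaces\<close>

instantiation poly_mapping :: (type, complex_vector) complex_vector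
begin

lift_definition scaleC_poly_mapping :: "complex \<Rightarrow> ('a \<Rightarrow>\<^sub>0 'b) \<Rightarrow> ('a \<Rightarrow>\<^sub>0 'b)"
  is "\<lambda>c f k. c *\<^sub>C f k"
  by (erule finite_subset[rotated]) auto

instance
  by standard (transfer; simp add: fun_eq_iff scaleC_add_right scaleC_add_left scaleC_scaleC scaleC_one)+

end

instantiation complex :: unital_complex_algebra
begin

definition scaleC_complex :: "complex \<Rightarrow> complex \<Rightarrow> complex"
  where "scaleC_complex = (*)"

instance
  by standard (simp_all add: scaleC_complex_def algebra_simps)

end

text \<open>
  \<open>V \<otimes> W\<close> is the free vector space on \<open>V \<times> W\<close> modulo the span of the bilinearity relators.
\<close>

abbreviation pure :: "'a \<Rightarrow> 'b \<Rightarrow> ('a \<times> 'b) \<Rightarrow>\<^sub>0 complex"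
  where "pure a b \<equiv> Poly_Mapping.single (a, b) 1"

definition tensor_relators :: "(('a::complex_vector \<times> 'b::complex_vector) \<Rightarrow>\<^sub>0 complex) set"
  where "tensor_relators =
    {pure (a + a') b - pure a b - pure a' b | a a' b. True} \<union>
    {pure a (b + b') - pure a b - pure a b' | a b b'. True} \<union>
    {pure (c *\<^sub>C a) b - c *\<^sub>C pure a b | c a b. True} \<union>
    {pure a (c *\<^sub>C b) - c *\<^sub>C pure a b | c a b. True}"

definition tensor_rel :: "(('a::complex_vector \<times> 'b::complex_vector) \<Rightarrow>\<^sub>0 complex) \<Rightarrow>
    (('a \<times> 'b) \<Rightarrow>\<^sub>0 complex) \<Rightarrow> bool"
  where "tensor_rel f g \<longleftrightarrow> f - g \<in> complex_vector.span tensor_relators"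

quotient_type (overloaded) ('a, 'b) tensor =
  "(('a::complex_vector \<times> 'b::complex_vector) \<Rightarrow>\<^sub>0 complex)" / tensor_rel
proof (rule equivpI)
  show "reflp tensor_rel"
    by (rule reflpI) (simp add: tensor_rel_def complex_vector.span_zero)
  show "symp tensor_rel"
    by (rule sympI, unfold tensor_rel_def) (drule complex_vector.span_neg, simp)
  show "transp tensor_rel"
    by (rule transpI, unfold tensor_rel_def) (drule (1) complex_vector.span_add, simp)
qed

instantiation tensor :: (complex_vector, complex_vector) complex_vector
begin

lift_definition zero_tensor :: "('a, 'b) tensor" is 0 .

lift_definition plus_tensor :: "('a, 'b) tensor \<Rightarrow> ('a, 'b) tensor \<Rightarrow> ('a, 'b) tensor" is "(+)"
  unfolding tensor_rel_def by (drule (1) complex_vector.span_add) (simp add: algebra_simps)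

lift_definition minus_tensor :: "('a, 'b) tensor \<Rightarrow> ('a, 'b) tensor \<Rightarrow> ('a, 'b) tensor" is "(-)"
  unfolding tensor_rel_def by (drule (1) complex_vector.span_diff) (simp add: algebra_simps)

lift_definition uminus_tensor :: "('a, 'b) tensor \<Rightarrow> ('a, 'b) tensor" is uminus
  unfolding tensor_rel_def by (drule complex_vector.span_neg) simp

lift_definition scaleC_tensor :: "complex \<Rightarrow> ('a, 'b) tensor \<Rightarrow> ('a, 'b) tensor" is scaleC
  unfolding tensor_rel_def
  by (drule complex_vector.span_scale) (simp add: complex_vector.scale_right_diff_distrib)

instance
  by standard
    (transfer; simp add: tensor_rel_def complex_vector.span_zero scaleC_add_right scaleC_add_left
      scaleC_scaleC scaleC_one algebra_simps)+

end

lift_definition tensor :: "'a::complex_vector \<Rightarrow> 'b::complex_vector \<Rightarrow> ('a, 'b) tensor"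
    (infixr \<open>\<otimes>\<close> 71) is pure .

lemma bilinearC_tensor: "bilinearC tensor"
proof (rule bilinearCI)
  fix a a' :: 'a and b b' :: 'b and c :: complex
  note defs = tensor_rel_def diff_diff_add[symmetric] tensor_relators_def
  show "a \<otimes> (b + b') = a \<otimes> b + a \<otimes> b'"
    by transfer (unfold defs, rule complex_vector.span_base, blast)
  show "(a + a') \<otimes> b = a \<otimes> b + a' \<otimes> b"
    by transfer (unfold defs, rule complex_vector.span_base, blast)
  show "a \<otimes> (c *\<^sub>C b) = c *\<^sub>C (a \<otimes> b)"
    by transfer (unfold defs, rule complex_vector.span_base, blast)
  show "(c *\<^sub>C a) \<otimes> b = c *\<^sub>C (a \<otimes> b)"
    by transfer (unfold defs, rule complex_vector.span_base, blast)
qed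

lemma scaleC_lookup: "Poly_Mapping.lookup (c *\<^sub>C f) k = c *\<^sub>C Poly_Mapping.lookup f k"
  by transfer simp

lemma free_decomp:
  "f = (\<Sum>k\<in>Poly_Mapping.keys f. Poly_Mapping.lookup f k *\<^sub>C Poly_Mapping.single k (1::complex))"
proof (rule poly_mapping_eqI)
  fix k
  show "Poly_Mapping.lookup f k = Poly_Mapping.lookup (\<Sum>k\<in>Poly_Mapping.keys f.
      Poly_Mapping.lookup f k *\<^sub>C Poly_Mapping.single k (1::complex)) k"
    by (simp add: lookup_sum scaleC_lookup lookup_single scaleC_complex_def when_def in_keys_iff
        if_distrib[of "(*) _"] sum.delta cong: if_cong)
qed

lemma tensor_induct [case_names pure add scale]:
  assumes pure: "\<And>a b. P (a \<otimes> b)"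
    and add: "\<And>s t. P s \<Longrightarrow> P t \<Longrightarrow> P (s + t)"
    and scale: "\<And>c t. P t \<Longrightarrow> P (c *\<^sub>C t)"
  shows "P t"
proof -
  have zero: "P 0"
    using scale[OF pure, of 0] by simp
  have sum: "P (abs_tensor (\<Sum>k\<in>K. l k *\<^sub>C Poly_Mapping.single k 1))" if "finite K"
    for K and l :: "'a \<times> 'b \<Rightarrow> complex"
    using that
  proof (induction K)
    case empty
    show ?case using zero by (simp add: zero_tensor_def)
  next
    case (insert k K)
    have "P (abs_tensor (l k *\<^sub>C Poly_Mapping.single k 1))"
      using scale[OF pure, of "l k" "fst k" "snd k"]
      by (simp add: tensor.abs_eq scaleC_tensor.abs_eq)
    with insert add show ?case
      by (simp add: plus_tensor.abs_eq[symmetric])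
  qed
  obtain f where "t = abs_tensor f"
    by (metis Quotient_tensor Quotient_abs_rep)
  then show ?thesis
    using sum[of "Poly_Mapping.keys f" "Poly_Mapping.lookup f"] free_decomp[of f] by simp
qed


subsection \<open>The universal property\<close>

definition free_extend :: "('k \<Rightarrow> 'c::complex_vector) \<Rightarrow> ('k \<Rightarrow>\<^sub>0 complex) \<Rightarrow> 'c"
  where "free_extend h f = (\<Sum>k\<in>Poly_Mapping.keys f. Poly_Mapping.lookup f k *\<^sub>C h k)"

lemma free_extend_single: "free_extend h (Poly_Mapping.single k 1) = h k"
  by (simp add: free_extend_def scaleC_one)

lemma clinear_free_extend: "clinear (free_extend h)"
proof (rule clinearI)
  fix f g and c
  show "free_extend h (f + g) = free_extend h f + free_extend h g"
    unfolding free_extend_def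
    by (rule setsum_keys_plus_distrib) (simp_all add: scaleC_add_left)
  show "free_extend h (c *\<^sub>C f) = c *\<^sub>C free_extend h f"
    unfolding free_extend_def complex_vector.scale_sum_right
    by (rule sum.mono_neutral_cong_left)
      (auto simp: in_keys_iff scaleC_lookup scaleC_complex_def)
qed

lemma free_extend_relators:
  assumes h: "bilinearC h" and r: "r \<in> complex_vector.span tensor_relators"
  shows "free_extend (case_prod h) r = 0"
  using r
proof (induction rule: complex_vector.span_induct_alt)
  case base
  show ?case by (rule clinear_zero[OF clinear_free_extend])
next
  case (step c x y)
  then have "free_extend (case_prod h) x = 0"
    by (auto simp: tensor_relators_def clinear_diff[OF clinear_free_extend]
        clinear_scaleC[OF clinear_free_extend] free_extend_single
        bilinearC_add_left[OF h] bilinearC_add_right[OF h]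
        bilinearC_scaleC_left[OF h] bilinearC_scaleC_right[OF h])
  with step show ?case
    by (simp add: clinear_add[OF clinear_free_extend] clinear_scaleC[OF clinear_free_extend])
qed

text \<open>
  For bilinear \<open>h\<close>, \<open>tensor_lift h\<close> is the linear map with \<open>a \<otimes> b \<mapsto> h a b\<close>; for other \<open>h\<close> its
  value depends on the choice of representatives.
\<close>

definition tensor_lift :: "('a::complex_vector \<Rightarrow> 'b::complex_vector \<Rightarrow> 'c::complex_vector) \<Rightarrow>
    ('a, 'b) tensor \<Rightarrow> 'c"
  where "tensor_lift h t = free_extend (case_prod h) (rep_tensor t)"

lemma tensor_lift_abs:
  assumes "bilinearC h"
  shows "tensor_lift h (abs_tensor f) = free_extend (case_prod h) f"
proof -
  have "tensor_rel (rep_tensor (abs_tensor f)) f"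
    by (simp add: Quotient_abs_rep[OF Quotient_tensor] flip: tensor.abs_eq_iff)
  then have "free_extend (case_prod h) (rep_tensor (abs_tensor f) - f) = 0"
    using assms free_extend_relators unfolding tensor_rel_def by blast
  then show ?thesis
    by (simp add: tensor_lift_def clinear_diff[OF clinear_free_extend])
qed

lemma tensor_lift_tensor: "bilinearC h \<Longrightarrow> tensor_lift h (a \<otimes> b) = h a b"
  by (simp add: tensor.abs_eq tensor_lift_abs free_extend_single)

lemma clinear_tensor_lift:
  fixes h :: "'a::complex_vector \<Rightarrow> 'b::complex_vector \<Rightarrow> 'c::complex_vector"
  assumes h: "bilinearC h"
  shows "clinear (tensor_lift h)"
proof (rule clinearI)
  fix s t :: "('a, 'b) tensor" and c
  obtain f g where [simp]: "s = abs_tensor f" "t = abs_tensor g"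
    by (metis Quotient_tensor Quotient_abs_rep)
  show "tensor_lift h (s + t) = tensor_lift h s + tensor_lift h t"
    by (simp add: plus_tensor.abs_eq tensor_lift_abs[OF h] clinear_add[OF clinear_free_extend])
  show "tensor_lift h (c *\<^sub>C s) = c *\<^sub>C tensor_lift h s"
    by (simp add: scaleC_tensor.abs_eq tensor_lift_abs[OF h] clinear_scaleC[OF clinear_free_extend])
qed


section \<open>The tensor product of algebras\<close>

lemma bilinearC_mult: "bilinearC ((*) :: 'a::unital_complex_algebra \<Rightarrow> 'a \<Rightarrow> 'a)"
  by (rule bilinearCI) (simp_all add: algebra_simps mult_scaleC_left mult_scaleC_right)

lemma bilinearC_tensor_mult_right:
  fixes a :: "'a::unital_complex_algebra" and b :: "'b::unital_complex_algebra"
  shows "bilinearC (\<lambda>c d. (a * c) \<otimes> (b * d))"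
  by (rule bilinearCI)
    (simp_all add: distrib_left mult_scaleC_right
      bilinearC_add_left[OF bilinearC_tensor] bilinearC_add_right[OF bilinearC_tensor]
      bilinearC_scaleC_left[OF bilinearC_tensor] bilinearC_scaleC_right[OF bilinearC_tensor])

lemma bilinearC_tensor_mult_left:
  fixes t :: "('a::unital_complex_algebra, 'b::unital_complex_algebra) tensor"
  shows "bilinearC (\<lambda>a b. tensor_lift (\<lambda>c d. (a * c) \<otimes> (b * d)) t)"
proof (induction t rule: tensor_induct)
  case (pure c d)
  show ?case
    unfolding tensor_lift_tensor[OF bilinearC_tensor_mult_right]
    by (rule bilinearCI)
      (simp_all add: distrib_right mult_scaleC_left
        bilinearC_add_left[OF bilinearC_tensor] bilinearC_add_right[OF bilinearC_tensor]
        bilinearC_scaleC_left[OF bilinearC_tensor] bilinearC_scaleC_right[OF bilinearC_tensor])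
next
  case (add s t)
  show ?case
    unfolding clinear_add[OF clinear_tensor_lift[OF bilinearC_tensor_mult_right]]
    by (rule bilinearCI)
      (simp_all add: add.IH[THEN bilinearC_add_left] add.IH[THEN bilinearC_add_right]
        add.IH[THEN bilinearC_scaleC_left] add.IH[THEN bilinearC_scaleC_right]
        scaleC_add_right ac_simps)
next
  case (scale c t)
  show ?case
    unfolding clinear_scaleC[OF clinear_tensor_lift[OF bilinearC_tensor_mult_right]]
    by (rule bilinearCI)
      (simp_all add: scale.IH[THEN bilinearC_add_left] scale.IH[THEN bilinearC_add_right]
        scale.IH[THEN bilinearC_scaleC_left] scale.IH[THEN bilinearC_scaleC_right]
        scaleC_add_right scaleC_scaleC mult.commute)
qed

text \<open>The product on \<open>A \<otimes> B\<close> is characterised by lemma \<open>tensor_mult_tensor\<close> below.\<close>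

instantiation tensor :: (unital_complex_algebra, unital_complex_algebra) unital_complex_algebra
begin

definition one_tensor :: "('a, 'b) tensor"
  where "one_tensor = 1 \<otimes> 1"

definition times_tensor :: "('a, 'b) tensor \<Rightarrow> ('a, 'b) tensor \<Rightarrow> ('a, 'b) tensor"
  where "times_tensor s t = tensor_lift (\<lambda>a b. tensor_lift (\<lambda>c d. (a * c) \<otimes> (b * d)) t) s"

lemma tensor_mult_tensor: "(a \<otimes> b) * (c \<otimes> d) = (a * c) \<otimes> (b * d)"
  for a c :: 'a and b d :: 'b
  unfolding times_tensor_def
  by (subst tensor_lift_tensor[OF bilinearC_tensor_mult_left])
    (rule tensor_lift_tensor[OF bilinearC_tensor_mult_right])

lemma bilinearC_times_tensor: "bilinearC ((*) :: ('a, 'b) tensor \<Rightarrow> _ \<Rightarrow> _)"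
proof -
  have left: "clinear (\<lambda>s. s * t)" for t :: "('a, 'b) tensor"
    unfolding times_tensor_def by (rule clinear_tensor_lift[OF bilinearC_tensor_mult_left])
  have "clinear ((*) s)" for s :: "('a, 'b) tensor"
  proof (induction s rule: tensor_induct)
    case (pure a b)
    have "(*) (a \<otimes> b) = tensor_lift (\<lambda>c d. (a * c) \<otimes> (b * d))"
      by (simp add: fun_eq_iff times_tensor_def tensor_lift_tensor[OF bilinearC_tensor_mult_left])
    then show ?case
      by (simp add: clinear_tensor_lift[OF bilinearC_tensor_mult_right])
  next
    case (add s s')
    show ?case
      by (rule clinearI)
        (simp_all add: clinear_add[OF left] clinear_add[OF add.IH(1)] clinear_add[OF add.IH(2)]
          clinear_scaleC[OF add.IH(1)] clinear_scaleC[OF add.IH(2)] scaleC_add_right)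
  next
    case (scale c s)
    show ?case
      by (rule clinearI)
        (simp_all add: clinear_scaleC[OF left] clinear_add[OF scale.IH] clinear_scaleC[OF scale.IH]
          scaleC_add_right scaleC_scaleC mult.commute)
  qed
  with left show ?thesis
    unfolding bilinearC_def by blast
qed

instance
proof
  fix s t u :: "('a, 'b) tensor" and c :: complex
  note bilin = bilinearC_add_left[OF bilinearC_times_tensor]
    bilinearC_add_right[OF bilinearC_times_tensor]
    bilinearC_scaleC_left[OF bilinearC_times_tensor]
    bilinearC_scaleC_right[OF bilinearC_times_tensor]
  show "(s + t) * u = s * u + t * u" "s * (t + u) = s * t + s * u"
    "c *\<^sub>C s * t = c *\<^sub>C (s * t)" "s * c *\<^sub>C t = c *\<^sub>C (s * t)"
    by (fact bilin)+
  show "1 * s = s"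
    by (induction s rule: tensor_induct) (simp_all add: one_tensor_def tensor_mult_tensor bilin)
  show "s * 1 = s"
    by (induction s rule: tensor_induct) (simp_all add: one_tensor_def tensor_mult_tensor bilin)
  have 1: "(a \<otimes> b) * (a' \<otimes> b') * u = (a \<otimes> b) * ((a' \<otimes> b') * u)" for a a' :: 'a and b b' :: 'b
    by (induction u rule: tensor_induct) (simp_all add: tensor_mult_tensor bilin mult.assoc)
  have 2: "(a \<otimes> b) * t * u = (a \<otimes> b) * (t * u)" for a :: 'a and b :: 'b
    by (induction t rule: tensor_induct) (simp_all add: 1 bilin)
  show "s * t * u = s * (t * u)"
    by (induction s rule: tensor_induct) (simp_all add: 2 bilin)
qed

end

definition mult_map :: "('a::unital_complex_algebra, 'a) tensor \<Rightarrow> 'a"  (\<open>\<mu>\<close>)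
  where "\<mu> = tensor_lift (*)"

lemma mult_map_tensor: "\<mu> (a \<otimes> b) = a * b"
  by (simp add: mult_map_def tensor_lift_tensor[OF bilinearC_mult])

lemma clinear_mult_map: "clinear \<mu>"
  unfolding mult_map_def by (rule clinear_tensor_lift[OF bilinearC_mult])


section \<open>Finite generation, commutators and brackets\<close>

definition subalgebra :: "'a::unital_complex_algebra set \<Rightarrow> bool"
  where "subalgebra S \<longleftrightarrow>
    complex_vector.subspace S \<and> 1 \<in> S \<and> (\<forall>a\<in>S. \<forall>b\<in>S. a * b \<in> S)"

definition generates_algebra :: "'a::unital_complex_algebra set \<Rightarrow> bool"
  where "generates_algebra X \<longleftrightarrow> subalgebra hull X = UNIV"

definition commutator_space :: "'a::unital_complex_algebra set"
  where "commutator_space = complex_vector.span {a * b - b * a | a b. True}"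

definition modified_double_Poisson_bracket ::
    "(('a::unital_complex_algebra, 'a) tensor \<Rightarrow> ('a, 'a) tensor) \<Rightarrow> bool"
  where "modified_double_Poisson_bracket br \<longleftrightarrow>
    clinear br \<and>
    (\<forall>a b c. br (a \<otimes> (b * c)) = (b \<otimes> 1) * br (a \<otimes> c) + br (a \<otimes> b) * (1 \<otimes> c)) \<and>
    (\<forall>a b c. br ((a * b) \<otimes> c) = (1 \<otimes> a) * br (b \<otimes> c) + br (a \<otimes> c) * (b \<otimes> 1)) \<and>
    (\<forall>a b c. \<mu> (br (a \<otimes> \<mu> (br (b \<otimes> c)))) - \<mu> (br (b \<otimes> \<mu> (br (a \<otimes> c)))) =
      \<mu> (br (\<mu> (br (a \<otimes> b)) \<otimes> c))) \<and>
    (\<forall>a b. \<mu> (br (a \<otimes> b)) + \<mu> (br (b \<otimes> a)) \<in> commutator_space)"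

definition H0_Poisson_structure :: "(('a::unital_complex_algebra, 'a) tensor \<Rightarrow> 'a) \<Rightarrow> bool"
  where "H0_Poisson_structure p \<longleftrightarrow>
    clinear p \<and>
    (\<forall>a b c. p (a \<otimes> (b * c)) = b * p (a \<otimes> c) + p (a \<otimes> b) * c) \<and>
    (\<forall>a b c. p ((a * b) \<otimes> c) = p ((b * a) \<otimes> c)) \<and>
    (\<forall>a b c. p (a \<otimes> p (b \<otimes> c)) - p (b \<otimes> p (a \<otimes> c)) = p (p (a \<otimes> b) \<otimes> c)) \<and>
    (\<forall>a b. p (a \<otimes> b) + p (b \<otimes> a) \<in> commutator_space)"

end

theory Submission
  imports Defs
begin

text \<open>
  Linearity, the Jacobi identity and skew-symmetry modulo commutators already speak about
  \<open>\<mu> \<circ> br\<close>, so only the two product rules need an argument. Applied to the first Leibniz rule,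
  \<open>\<mu>\<close> turns the outer factors \<open>b \<otimes> 1\<close> and \<open>1 \<otimes> c\<close> into ordinary left and right multiplication,
  which gives the derivation rule. In the second Leibniz rule the factors are inner ones:
  both \<open>(1 \<otimes> a) * (u \<otimes> v)\<close> and \<open>(u \<otimes> v) * (a \<otimes> 1)\<close> have image \<open>u * a * v\<close> under \<open>\<mu>\<close>.
  Hence \<open>{a b, c}\<close> is obtained by inserting \<open>a\<close> into the middle of \<open>br (b \<otimes> c)\<close>, inserting \<open>b\<close>
  into the middle of \<open>br (a \<otimes> c)\<close>, and adding, which is symmetric in \<open>a\<close> and \<open>b\<close>.
\<close>

lemmas tensor_algebra_simps = distrib_left distrib_right mult_scaleC_left mult_scaleC_right
  tensor_mult_tensor mult_map_tensor clinear_add[OF clinear_mult_map]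
  clinear_scaleC[OF clinear_mult_map] mult.assoc

lemma mult_map_outer_left: "\<mu> ((b \<otimes> 1) * t) = b * \<mu> t"
  by (induction t rule: tensor_induct) (simp_all add: tensor_algebra_simps)

lemma mult_map_outer_right: "\<mu> (t * (1 \<otimes> c)) = \<mu> t * c"
  by (induction t rule: tensor_induct) (simp_all add: tensor_algebra_simps)

lemma mult_map_inner: "\<mu> ((1 \<otimes> a) * t) = \<mu> (t * (a \<otimes> 1))"
  by (induction t rule: tensor_induct) (simp_all add: tensor_algebra_simps)

theorem corollary2:
  fixes X :: "'a::unital_complex_algebra set"
    and br :: "('a, 'a) tensor \<Rightarrow> ('a, 'a) tensor"
  assumes "finite X" and "generates_algebra X"
    and "modified_double_Poisson_bracket br"
  shows "H0_Poisson_structure (\<mu> \<circ> br)"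
proof -
  have lin: "clinear br"
    and leibniz_right: "\<And>a b c. br (a \<otimes> (b * c)) = (b \<otimes> 1) * br (a \<otimes> c) + br (a \<otimes> b) * (1 \<otimes> c)"
    and leibniz_left: "\<And>a b c. br ((a * b) \<otimes> c) = (1 \<otimes> a) * br (b \<otimes> c) + br (a \<otimes> c) * (b \<otimes> 1)"
    and jacobi: "\<And>a b c. \<mu> (br (a \<otimes> \<mu> (br (b \<otimes> c)))) - \<mu> (br (b \<otimes> \<mu> (br (a \<otimes> c)))) =
      \<mu> (br (\<mu> (br (a \<otimes> b)) \<otimes> c))"
    and skew: "\<And>a b. \<mu> (br (a \<otimes> b)) + \<mu> (br (b \<otimes> a)) \<in> commutator_space"
    using assms(3) unfolding modified_double_Poisson_bracket_def by blast+
  have "clinear (\<mu> \<circ> br)"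
    by (rule clinearI) (simp_all add: clinear_add[OF lin] clinear_scaleC[OF lin]
        clinear_add[OF clinear_mult_map] clinear_scaleC[OF clinear_mult_map])
  moreover have "\<mu> (br (a \<otimes> (b * c))) = b * \<mu> (br (a \<otimes> c)) + \<mu> (br (a \<otimes> b)) * c" for a b c
    by (simp add: leibniz_right clinear_add[OF clinear_mult_map]
        mult_map_outer_left mult_map_outer_right)
  moreover have "\<mu> (br ((a * b) \<otimes> c)) = \<mu> (br ((b * a) \<otimes> c))" for a b c
    by (simp add: leibniz_left clinear_add[OF clinear_mult_map] mult_map_inner add.commute)
  ultimately show ?thesis
    unfolding H0_Poisson_structure_def comp_apply using jacobi skew by blast
qed

end
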